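(* Let $\mathcal{A}\in T(m,n)$. If $\mathcal{A}$ can be written as $\mathcal{A}=c\mathcal{I}-\mathcal{B}$ with $\mathcal{B}\ge 0$ and $c>\rho(\mathcal{B})+1$, then for every positive vector $\mathbf{b}\in\mathbb{R}^n$ the tensor absolute value equation $$\mathcal{A}\mathbf{x}^{m-1}-|\mathbf{x}|^{[m-1]}=\mathbf{b}$$ has a unique positive solution $\mathbf{x}\in\mathbb{R}^n$.
   Context: Throughout $m\ge 2$, and all tensors are real. $T(m,n)$ is the set of real $m$th-order $n$-dimensional tensors $\mathcal{A}=(a_{i_1i_2\ldots i_m})$, $1\le i_1,\ldots,i_m\le n$. For $\mathbf{x}\in\mathbb{R}^n$, $\mathcal{A}\mathbf{x}^{m-1}\in\mathbb{R}^n$ has components $(\mathcal{A}\mathbf{x}^{m-1})_i=\sum_{i_2,\ldots,i_m=1}^n a_{ii_2\ldots i_m}x_{i_2}\cdots x_{i_m}$; $\mathbf{x}^{[m-1]}=(x_1^{m-1},\ldots,x_n^{m-1})^T$; $|\mathbf{x}|^{[m-1]}=(|x_1|^{m-1},\ldots,|x_n|^{m-1})^T$. A vector is positive if all its components are positive. $\mathcal{I}\in T(m,n)$ is the unit tensor, with entries $1$ if $i_1=\cdots=i_m$ and $0$ otherwise. $\mathcal{B}\ge 0$ means all entries of $\mathcal{B}$ are nonnegative. A scalar $\lambda\in\mathbb{R}$ is an eigenvalue of $\mathcal{B}$ if $\mathcal{B}\mathbf{x}^{m-1}=\lambda\mathbf{x}^{[m-1]}$ for some nonzero $\mathbf{x}\in\mathbb{R}^n$,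 and the spectral radius is $\rho(\mathcal{B})=\max\{|\lambda| : \lambda \text{ is an eigenvalue of } \mathcal{B}\}$. *)

theory Defs
  imports "HOL-Analysis.Analysis"
begin

text \<open>
  The entry with indices \<open>i\<^sub>1, \<dots>, i\<^sub>m\<close> of an \<open>m\<close>-th order tensor is its value at the list
  \<open>[i\<^sub>1, \<dots>, i\<^sub>m]\<close>; the index range is the finite type \<open>'n\<close>, so the dimension is \<open>CARD('n)\<close>.
  Tensors of order \<open>m\<close> vanish on lists of any other length, so that two of them are equal as
  functions exactly if they have the same entries.
\<close>

type_synonym 'n tensor = "'n list \<Rightarrow> real"

definition tensors :: "nat \<Rightarrow> 'n tensor set" where
  "tensors m = {A. \<forall>is. length is \<noteq> m \<longrightarrow> A is = 0}"

definition unit_tensor :: "nat \<Rightarrow> 'n tensor" where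
  "unit_tensor m = (\<lambda>is. if \<exists>i. is = replicate m i then 1 else 0)"

definition nonneg_tensor :: "nat \<Rightarrow> 'n tensor \<Rightarrow> bool" where
  "nonneg_tensor m B \<longleftrightarrow> (\<forall>is. length is = m \<longrightarrow> 0 \<le> B is)"

text \<open>The vector \<open>A x\<^bsup>m-1\<^esup>\<close>; the list \<open>js\<close> is \<open>[i\<^sub>2, \<dots>, i\<^sub>m]\<close>.\<close>

definition tensor_apply :: "nat \<Rightarrow> 'n tensor \<Rightarrow> real ^ 'n \<Rightarrow> real ^ 'n::finite" where
  "tensor_apply m A x =
     (\<chi> i. \<Sum>js | length js = m - 1. A (i # js) * (\<Prod>j\<leftarrow>js. x $ j))"

text \<open>The componentwise power \<open>x\<^bsup>[k]\<^esup>\<close>.\<close>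

definition vec_power :: "real ^ 'n \<Rightarrow> nat \<Rightarrow> real ^ 'n::finite" where
  "vec_power x k = (\<chi> i. (x $ i) ^ k)"

definition positive_vec :: "real ^ 'n::finite \<Rightarrow> bool" where
  "positive_vec x \<longleftrightarrow> (\<forall>i. 0 < x $ i)"

definition tensor_eigenvalue :: "nat \<Rightarrow> 'n::finite tensor \<Rightarrow> real \<Rightarrow> bool" where
  "tensor_eigenvalue m B \<mu> \<longleftrightarrow>
     (\<exists>x. x \<noteq> 0 \<and> tensor_apply m B x = \<mu> *\<^sub>R vec_power x (m - 1))"

text \<open>
  The maximum is written as a supremum, because \<open>Max\<close> is meaningful only for sets already known to
  be finite. By the lemma \<open>tensor_spectral_radius_is_max\<close> below, the supremum is attained as soon as
  there is an eigenvalue; without eigenvalues, the value is unspecified.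
\<close>

definition tensor_spectral_radius :: "nat \<Rightarrow> 'n::finite tensor \<Rightarrow> real" where
  "tensor_spectral_radius m B = Sup {\<bar>\<mu>\<bar> | \<mu>. tensor_eigenvalue m B \<mu>}"

lemma finite_index_lists: "finite {js :: 'n::finite list. length js = k}"
  using finite_lists_length_eq[of "UNIV :: 'n set" k] by simp

lemma continuous_on_prod_list_nth:
  "continuous_on S (\<lambda>x :: real ^ 'n::finite. \<Prod>j\<leftarrow>js. x $ j)"
  by (induction js) (auto intro!: continuous_intros)

lemma continuous_on_tensor_apply: "continuous_on S (tensor_apply m B)"
  unfolding tensor_apply_def
  by (intro continuous_intros continuous_on_prod_list_nth)

lemma continuous_on_vec_power: "continuous_on S (\<lambda>x. vec_power x k)"
  unfolding vec_power_def by (intro continuous_intros)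

lemma prod_list_nth_scale:
  "(\<Prod>j\<leftarrow>js. (t *\<^sub>R x) $ j) = t ^ length js * (\<Prod>j\<leftarrow>js. (x :: real ^ 'n::finite) $ j)"
  by (induction js) auto

lemma tensor_apply_scale: "tensor_apply m B (t *\<^sub>R x) = t ^ (m - 1) *\<^sub>R tensor_apply m B x"
  unfolding tensor_apply_def
  by (simp only: vec_eq_iff prod_list_nth_scale)
     (auto simp: sum_distrib_left intro!: sum.cong)

lemma vec_power_scale: "vec_power (t *\<^sub>R x) k = t ^ k *\<^sub>R vec_power x k"
  unfolding vec_power_def by (simp add: vec_eq_iff power_mult_distrib)

lemma tensor_eigenvalue_sphere:
  "tensor_eigenvalue m B \<mu> \<longleftrightarrow>
     (\<exists>x\<in>sphere 0 1. tensor_apply m B x = \<mu> *\<^sub>R vec_power x (m - 1))"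
proof
  assume "tensor_eigenvalue m B \<mu>"
  then obtain x where x: "x \<noteq> 0" "tensor_apply m B x = \<mu> *\<^sub>R vec_power x (m - 1)"
    unfolding tensor_eigenvalue_def by blast
  let ?y = "inverse (norm x) *\<^sub>R x"
  have "tensor_apply m B ?y = \<mu> *\<^sub>R vec_power ?y (m - 1)"
    using x by (simp only: tensor_apply_scale vec_power_scale) (simp add: mult.commute)
  moreover have "?y \<in> sphere 0 1" using x by simp
  ultimately show "\<exists>x\<in>sphere 0 1. tensor_apply m B x = \<mu> *\<^sub>R vec_power x (m - 1)" by blast
next
  assume "\<exists>x\<in>sphere 0 1. tensor_apply m B x = \<mu> *\<^sub>R vec_power x (m - 1)"
  then obtain x where "x \<in> sphere 0 1" "tensor_apply m B x = \<mu> *\<^sub>R vec_power x (m - 1)" by blast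
  moreover from this have "x \<noteq> 0" by auto
  ultimately show "tensor_eigenvalue m B \<mu>" unfolding tensor_eigenvalue_def by blast
qed

lemma compact_eigenvalues: "compact {\<mu>. tensor_eigenvalue m (B :: 'n::finite tensor) \<mu>}"
proof -
  let ?S = "sphere 0 1 :: (real ^ 'n) set"
  let ?h = "\<lambda>x :: real ^ 'n. norm (vec_power x (m - 1))"
  have ne: "?S \<noteq> {}" by simp
  have "continuous_on ?S ?h" by (intro continuous_intros continuous_on_vec_power)
  from continuous_attains_inf[OF compact_sphere ne this]
  obtain z where z: "z \<in> ?S" "\<And>x. x \<in> ?S \<Longrightarrow> ?h z \<le> ?h x" by blast
  have "z \<noteq> 0" using z(1) by auto
  then have "?h z > 0" by (auto simp: vec_power_def vec_eq_iff)
  have "compact (tensor_apply m B ` ?S)"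
    by (intro compact_continuous_image continuous_on_tensor_apply compact_sphere)
  then have "bounded (tensor_apply m B ` ?S)" by (rule compact_imp_bounded)
  then have "\<exists>K. \<forall>x\<in>?S. norm (tensor_apply m B x) \<le> K"
    by (simp only: bounded_iff ball_simps)
  then obtain K where K: "\<forall>x\<in>?S. norm (tensor_apply m B x) \<le> K" ..
  have bound: "\<bar>\<mu>\<bar> \<le> K / ?h z" if "tensor_eigenvalue m B \<mu>" for \<mu>
  proof -
    obtain x where x: "x \<in> ?S" "tensor_apply m B x = \<mu> *\<^sub>R vec_power x (m - 1)"
      using \<open>tensor_eigenvalue m B \<mu>\<close> tensor_eigenvalue_sphere by blast
    have "\<bar>\<mu>\<bar> * ?h z \<le> \<bar>\<mu>\<bar> * ?h x" using z(2)[OF x(1)] by (simp add: mult_left_mono)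
    also have "\<dots> \<le> K" using bspec[OF K x(1)] x(2) by simp
    finally show ?thesis using \<open>?h z > 0\<close> by (simp add: pos_le_divide_eq)
  qed
  let ?C = "cball (0 :: real) (K / ?h z) \<times> ?S"
  let ?g = "\<lambda>p :: real \<times> (real ^ 'n). tensor_apply m B (snd p) - fst p *\<^sub>R vec_power (snd p) (m - 1)"
  have "continuous_on ?C ?g"
    by (intro continuous_intros continuous_on_compose2[OF continuous_on_tensor_apply[of UNIV]]
        continuous_on_compose2[OF continuous_on_vec_power[of UNIV]]) auto
  then have "closed (?C \<inter> ?g -` {0})"
    by (intro continuous_closed_preimage) (auto intro!: closed_Times)
  moreover have "compact ?C" by (intro compact_Times compact_cball compact_sphere)
  ultimately have "compact (?C \<inter> ?g -` {0})"
    using compact_Int_closed[of ?C "?C \<inter> ?g -` {0}"] by (simp only: Int_left_absorb)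
  then have "compact (fst ` (?C \<inter> ?g -` {0}))"
    by (intro compact_continuous_image continuous_intros)
  moreover have "fst ` (?C \<inter> ?g -` {0}) = {\<mu>. tensor_eigenvalue m B \<mu>}"
  proof (intro set_eqI iffI)
    fix \<mu> assume "\<mu> \<in> fst ` (?C \<inter> ?g -` {0})"
    then show "\<mu> \<in> {\<mu>. tensor_eigenvalue m B \<mu>}" by (auto simp: tensor_eigenvalue_sphere)
  next
    fix \<mu> assume *: "\<mu> \<in> {\<mu>. tensor_eigenvalue m B \<mu>}"
    then obtain x where "x \<in> ?S" "tensor_apply m B x = \<mu> *\<^sub>R vec_power x (m - 1)"
      by (auto simp: tensor_eigenvalue_sphere)
    then have "(\<mu>, x) \<in> ?C \<inter> ?g -` {0}" using bound[of \<mu>] * by (auto simp: dist_real_def)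
    then show "\<mu> \<in> fst ` (?C \<inter> ?g -` {0})" by (rule image_eqI[rotated]) simp
  qed
  ultimately show ?thesis by simp
qed

lemma tensor_spectral_radius_is_max:
  assumes "tensor_eigenvalue m B \<nu>"
  shows "tensor_spectral_radius m B \<in> {\<bar>\<mu>\<bar> | \<mu>. tensor_eigenvalue m B \<mu>}"
    and "tensor_eigenvalue m B \<mu> \<Longrightarrow> \<bar>\<mu>\<bar> \<le> tensor_spectral_radius m B"
proof -
  let ?M = "{\<bar>\<mu>\<bar> | \<mu>. tensor_eigenvalue m B \<mu>}"
  have "?M = abs ` {\<mu>. tensor_eigenvalue m B \<mu>}" by blast
  moreover have "compact (abs ` {\<mu>. tensor_eigenvalue m B \<mu>})"
    by (intro compact_continuous_image compact_eigenvalues continuous_intros)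
  ultimately have "compact ?M" by simp
  moreover have "?M \<noteq> {}" using assms by blast
  ultimately show "tensor_spectral_radius m B \<in> ?M"
    unfolding tensor_spectral_radius_def
    by (intro closed_contains_Sup compact_imp_closed bounded_imp_bdd_above compact_imp_bounded)
  show "tensor_eigenvalue m B \<mu> \<Longrightarrow> \<bar>\<mu>\<bar> \<le> tensor_spectral_radius m B"
    unfolding tensor_spectral_radius_def using \<open>compact ?M\<close>
    by (intro cSup_upper bounded_imp_bdd_above compact_imp_bounded) auto
qed

end

theory Submission
  imports Defs
begin

text \<open>
  Put \<open>k = m - 1\<close>. For positive \<open>x\<close> the absolute value is invisible, and since
  \<open>A = c I - B\<close> the equation says \<open>(c - 1) x\<^bsup>[k]\<^esup> = B x\<^bsup>k\<^esup> + b\<close>. The substitution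
  \<open>y = x\<^bsup>[k]\<^esup>\<close> turns it into \<open>s y = T y + b\<close> with \<open>s = c - 1\<close> and \<open>T y = B (y\<^bsup>[1/k]\<^esup>)\<^bsup>k\<^esup>\<close>.
  On the nonnegative orthant this \<open>T\<close> shares with a nonnegative matrix the properties that matter:
  it is continuous, order preserving and homogeneous of degree one. Its nonnegative eigenvectors are
  the \<open>k\<close>-th powers of nonnegative eigenvectors of \<open>B\<close>, so their eigenvalues are at most the
  spectral radius of \<open>B\<close>, hence less than \<open>s\<close>. What remains is nonlinear Perron--Frobenius theory.

  Existence (\<open>resolvent_solution_exists\<close>): Brouwer's theorem on the probability simplex solves
  \<open>T y + e b = \<lambda> y\<close> for every \<open>e > 0\<close>. As \<open>e\<close> tends to \<open>0\<close>, a subsequence of these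
  solutions converges to an eigenvector of \<open>T\<close>, and the \<open>\<lambda>\<close> converge to its eigenvalue
  (\<open>eigenvector_as_limit_of_perturbed\<close>). So \<open>\<lambda> < s\<close> for some \<open>e\<close>, and then \<open>w = y / e\<close>
  satisfies \<open>T w + b \<le> s w\<close>. The map \<open>y \<mapsto> (T y + b) / s\<close> therefore sends the box between
  \<open>0\<close> and \<open>w\<close> into itself, and Brouwer's theorem gives a fixed point.

  Uniqueness (\<open>resolvent_solution_le\<close>): if \<open>t\<close> is the least number with \<open>y \<le> t z\<close> for two
  solutions \<open>y\<close> and \<open>z\<close>, then \<open>t > 1\<close> is impossible, because replacing \<open>b\<close> by \<open>t b\<close>
  strictly increases every component of the right-hand side.
\<close>

section \<open>Order-preserving homogeneous maps of the nonnegative orthant\<close>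

definition prob_simplex :: "(real ^ 'n::finite) set" where
  "prob_simplex = {y. 0 \<le> y \<and> (\<Sum>i\<in>UNIV. y $ i) = 1}"

lemma compact_prob_simplex: "compact (prob_simplex :: (real ^ 'n::finite) set)"
proof -
  have "prob_simplex \<subseteq> cbox 0 (1 :: real ^ 'n)"
  proof
    fix y :: "real ^ 'n" assume y: "y \<in> prob_simplex"
    then have nonneg: "0 \<le> y $ i" for i by (simp add: prob_simplex_def less_eq_vec_def)
    have "y $ i \<le> 1" for i
      using member_le_sum[of i UNIV "\<lambda>i. y $ i"] nonneg y by (simp add: prob_simplex_def)
    with nonneg show "y \<in> cbox 0 1" by (simp add: mem_box_cart)
  qed
  then have "bounded (prob_simplex :: (real ^ 'n) set)"
    using bounded_cbox bounded_subset by blast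
  moreover have "closed (prob_simplex :: (real ^ 'n) set)"
    unfolding prob_simplex_def less_eq_vec_def
    by (intro closed_Collect_conj closed_Collect_all closed_Collect_le closed_Collect_eq
        continuous_intros)
  ultimately show ?thesis by (simp add: compact_eq_bounded_closed)
qed

lemma convex_prob_simplex: "convex (prob_simplex :: (real ^ 'n::finite) set)"
  by (rule convexI)
    (auto simp: prob_simplex_def less_eq_vec_def sum.distrib simp flip: sum_distrib_left)

lemma prob_simplex_nonempty: "(prob_simplex :: (real ^ 'n::finite) set) \<noteq> {}"
proof -
  have "axis (undefined :: 'n) (1::real) \<in> prob_simplex"
    by (auto simp: prob_simplex_def less_eq_vec_def axis_def)
  then show ?thesis by blast
qed

text \<open>
  On the simplex the vector \<open>T y + b\<close> has positive components, so it can be divided by their sum.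
  The result depends continuously on \<open>y\<close> and lies in the simplex again; its fixed point is \<open>y\<close>.
\<close>

lemma perturbed_eigenvector_in_simplex:
  fixes T :: "real ^ 'n::finite \<Rightarrow> real ^ 'n"
  assumes cont: "continuous_on {y. 0 \<le> y} T"
    and nonneg: "\<And>y. 0 \<le> y \<Longrightarrow> 0 \<le> T y"
    and b: "positive_vec b"
  obtains y where "y \<in> prob_simplex" and "T y + b = (\<Sum>i\<in>UNIV. (T y + b) $ i) *\<^sub>R y"
proof -
  let ?S = "prob_simplex :: (real ^ 'n) set"
  define \<sigma> where "\<sigma> y = (\<Sum>i\<in>UNIV. (T y + b) $ i)" for y
  define G where "G y = inverse (\<sigma> y) *\<^sub>R (T y + b)" for y
  have sub: "?S \<subseteq> {y. 0 \<le> y}" by (auto simp: prob_simplex_def)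
  have pos: "0 < (T y + b) $ i" if "y \<in> ?S" for y i
    using nonneg[of y] b sub that
    by (auto simp: less_eq_vec_def positive_vec_def add_nonneg_pos)
  have \<sigma>_pos: "0 < \<sigma> y" if "y \<in> ?S" for y
    unfolding \<sigma>_def using pos[OF that] by (intro sum_pos) auto
  have contT: "continuous_on ?S T" using cont sub continuous_on_subset by blast
  have "continuous_on ?S \<sigma>" unfolding \<sigma>_def by (intro continuous_intros contT)
  then have "continuous_on ?S G" unfolding G_def
    using \<sigma>_pos by (intro continuous_intros contT) (auto simp: less_imp_neq[symmetric])
  moreover have "G \<in> ?S \<rightarrow> ?S"
  proof
    fix y assume y: "y \<in> ?S"
    have "0 \<le> G y $ i" for i
      unfolding G_def using pos[OF y, of i] \<sigma>_pos[OF y] by simp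
    moreover have "(\<Sum>i\<in>UNIV. G y $ i) = inverse (\<sigma> y) * \<sigma> y"
      unfolding G_def \<sigma>_def by (simp add: sum_distrib_left)
    ultimately show "G y \<in> ?S"
      using \<sigma>_pos[OF y] by (simp add: prob_simplex_def less_eq_vec_def)
  qed
  ultimately obtain y where y: "y \<in> ?S" "G y = y"
    using brouwer[OF compact_prob_simplex convex_prob_simplex prob_simplex_nonempty] by blast
  have "T y + b = \<sigma> y *\<^sub>R G y" using \<sigma>_pos[OF y(1)] by (simp add: G_def)
  then show ?thesis using y that unfolding \<sigma>_def by simp
qed

text \<open>
  The simplex is compact, so the perturbed eigenvectors for \<open>e = 1, 1/2, 1/3, \<dots>\<close> accumulate at
  an eigenvector. The last conclusion is what the approximation is for: any \<open>s\<close> above the limit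
  \<open>L\<close> of the perturbed eigenvalues exceeds one of them, so the perturbed equation becomes an
  inequality. The eigenvector \<open>z\<close> alone would not give it, as it may have zero components.
\<close>

lemma eigenvector_as_limit_of_perturbed:
  fixes T :: "real ^ 'n::finite \<Rightarrow> real ^ 'n"
  assumes cont: "continuous_on {y. 0 \<le> y} T"
    and nonneg: "\<And>y. 0 \<le> y \<Longrightarrow> 0 \<le> T y"
    and b: "positive_vec b"
  obtains L z where "0 \<le> L" and "0 \<le> z" and "z \<noteq> 0" and "T z = L *\<^sub>R z"
    and "\<And>s. L < s \<Longrightarrow> \<exists>e>0. \<exists>y\<ge>0. T y + e *\<^sub>R b \<le> s *\<^sub>R y"
proof -
  let ?S = "prob_simplex :: (real ^ 'n) set"
  define e where "e n = inverse (real (Suc n))" for n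
  have e_pos: "0 < e n" for n by (simp add: e_def)
  have e_lim: "e \<longlonglongrightarrow> 0" unfolding e_def by (rule LIMSEQ_inverse_real_of_nat)
  define \<sigma> where "\<sigma> n y = (\<Sum>i\<in>UNIV. (T y + e n *\<^sub>R b) $ i)" for n y
  have "\<exists>y\<in>?S. T y + e n *\<^sub>R b = \<sigma> n y *\<^sub>R y" for n
  proof -
    have "positive_vec (e n *\<^sub>R b)" using b e_pos by (simp add: positive_vec_def)
    from perturbed_eigenvector_in_simplex[OF cont nonneg this]
    show ?thesis unfolding \<sigma>_def by blast
  qed
  then obtain Y where Y: "\<And>n. Y n \<in> ?S" "\<And>n. T (Y n) + e n *\<^sub>R b = \<sigma> n (Y n) *\<^sub>R Y n"
    by metis
  from compact_prob_simplex Y(1) obtain z r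
    where z: "z \<in> ?S" and r: "strict_mono (r :: nat \<Rightarrow> nat)" and lim: "(Y \<circ> r) \<longlonglongrightarrow> z"
    unfolding compact_def by metis
  have z0: "0 \<le> z" and sum_z: "(\<Sum>i\<in>UNIV. z $ i) = 1" using z by (auto simp: prob_simplex_def)
  have Y0: "0 \<le> Y n" for n using Y(1)[of n] by (simp add: prob_simplex_def)
  have "continuous_on ?S T"
    using cont by (rule continuous_on_subset) (auto simp: prob_simplex_def)
  then have "(T \<circ> (Y \<circ> r)) \<longlonglongrightarrow> T z"
    using Y(1) z lim unfolding continuous_on_sequentially by auto
  moreover have "(e \<circ> r) \<longlonglongrightarrow> 0" using e_lim r by (rule LIMSEQ_subseq_LIMSEQ)
  ultimately have lim_pert: "(\<lambda>n. T (Y (r n)) + e (r n) *\<^sub>R b) \<longlonglongrightarrow> T z + 0 *\<^sub>R b"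
    unfolding comp_def by (intro tendsto_intros)
  define L where "L = (\<Sum>i\<in>UNIV. T z $ i)"
  have lim_\<sigma>: "(\<lambda>n. \<sigma> (r n) (Y (r n))) \<longlonglongrightarrow> L"
    unfolding \<sigma>_def L_def using tendsto_vec_nth[OF lim_pert] by (intro tendsto_sum) simp
  have "(\<lambda>n. \<sigma> (r n) (Y (r n)) *\<^sub>R Y (r n)) \<longlonglongrightarrow> L *\<^sub>R z"
    using lim unfolding comp_def by (intro tendsto_scaleR lim_\<sigma>)
  with lim_pert have eig: "T z = L *\<^sub>R z" unfolding Y(2) by (simp add: LIMSEQ_unique)
  have "0 \<le> L" unfolding L_def using nonneg[OF z0] by (auto simp: less_eq_vec_def intro!: sum_nonneg)
  moreover have "z \<noteq> 0" using sum_z by auto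
  moreover have "\<exists>e>0. \<exists>y\<ge>0. T y + e *\<^sub>R b \<le> s *\<^sub>R y" if "L < s" for s
  proof -
    from order_tendstoD(2)[OF lim_\<sigma> that] obtain n where n: "\<sigma> (r n) (Y (r n)) < s"
      using eventually_sequentially by auto
    then have "T (Y (r n)) + e (r n) *\<^sub>R b \<le> s *\<^sub>R Y (r n)"
      using Y0[of "r n"] unfolding Y(2) by (auto simp: less_eq_vec_def intro!: mult_right_mono)
    then show ?thesis using e_pos Y0 by blast
  qed
  ultimately show ?thesis using that z0 eig by blast
qed

text \<open>
  The inequality \<open>T v + e b \<le> s v\<close> from the previous lemma scales, by homogeneity, to an upper
  solution \<open>w\<close> of the equation; since \<open>T\<close> preserves the order, the solution operator
  \<open>y \<mapsto> (T y + b) / s\<close> cannot leave the box below \<open>w\<close>.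
\<close>

lemma resolvent_solution_exists:
  fixes T :: "real ^ 'n::finite \<Rightarrow> real ^ 'n"
  assumes cont: "continuous_on {y. 0 \<le> y} T"
    and mono: "\<And>y z. 0 \<le> y \<Longrightarrow> y \<le> z \<Longrightarrow> T y \<le> T z"
    and hom: "\<And>t y. 0 \<le> t \<Longrightarrow> T (t *\<^sub>R y) = t *\<^sub>R T y"
    and eig: "\<And>\<mu> z. 0 \<le> z \<Longrightarrow> z \<noteq> 0 \<Longrightarrow> T z = \<mu> *\<^sub>R z \<Longrightarrow> \<mu> < s"
    and b: "positive_vec b"
  obtains y where "positive_vec y" and "s *\<^sub>R y = T y + b"
proof -
  have "T 0 = 0" using hom[of 0 0] by simp
  then have nonneg: "0 \<le> T y" if "0 \<le> y" for y using mono[of 0 y] that by simp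
  obtain L z where L: "0 \<le> L" "0 \<le> z" "z \<noteq> 0" "T z = L *\<^sub>R z"
    and super: "\<And>s. L < s \<Longrightarrow> \<exists>e>0. \<exists>y\<ge>0. T y + e *\<^sub>R b \<le> s *\<^sub>R y"
    using eigenvector_as_limit_of_perturbed[OF cont nonneg b] by metis
  have "L < s" using eig L by blast
  then have s: "0 < s" using L(1) by simp
  obtain e v where e: "0 < e" and v: "0 \<le> v" "T v + e *\<^sub>R b \<le> s *\<^sub>R v"
    using super[OF \<open>L < s\<close>] by blast
  define w where "w = inverse e *\<^sub>R v"
  have w0: "0 \<le> w" using e v(1) by (simp add: w_def less_eq_vec_def)
  have "inverse e *\<^sub>R (T v + e *\<^sub>R b) \<le> inverse e *\<^sub>R (s *\<^sub>R v)"
    using e v(2) by (intro scaleR_left_mono) auto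
  then have w: "T w + b \<le> s *\<^sub>R w"
    using e by (simp add: w_def hom scaleR_add_right mult.commute)
  define G where "G y = inverse s *\<^sub>R (T y + b)" for y
  have sG: "s *\<^sub>R G y = T y + b" for y using s by (simp add: G_def)
  have box: "cbox 0 w = {0..w}" by (simp add: interval_cbox)
  have "continuous_on (cbox 0 w) T"
    using cont by (rule continuous_on_subset) (auto simp: box)
  then have "continuous_on (cbox 0 w) G" unfolding G_def by (intro continuous_intros)
  moreover have "G \<in> cbox 0 w \<rightarrow> cbox 0 w"
  proof
    fix y assume "y \<in> cbox 0 w"
    then have y: "0 \<le> y" "y \<le> w" by (auto simp: box)
    have "0 \<le> b" using b by (auto simp: positive_vec_def less_eq_vec_def less_imp_le)
    then have "0 \<le> G y" unfolding G_def using s nonneg[OF y(1)] by (intro scaleR_nonneg_nonneg) auto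
    moreover have "s *\<^sub>R G y \<le> s *\<^sub>R w"
      unfolding sG using mono[OF y] w by (meson add_right_mono order_trans)
    then have "G y \<le> w" using s by (simp add: less_eq_vec_def)
    ultimately show "G y \<in> cbox 0 w" by (simp add: box)
  qed
  moreover have "cbox 0 w \<noteq> {}" using w0 by (auto simp: box)
  ultimately obtain y where y: "y \<in> cbox 0 w" "G y = y"
    using brouwer[OF compact_cbox convex_box(1)] by blast
  have eq: "s *\<^sub>R y = T y + b" using sG[of y] y(2) by simp
  have "0 < y $ i" for i
  proof -
    have "0 \<le> T y" using y(1) nonneg by (auto simp: box)
    then have "0 < (T y + b) $ i"
      using b by (simp add: less_eq_vec_def positive_vec_def add_nonneg_pos)
    then show ?thesis using s unfolding eq[symmetric] by (simp add: zero_less_mult_iff)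
  qed
  then show ?thesis using that[of y] eq by (simp add: positive_vec_def)
qed

text \<open>
  A comparison at the index where \<open>y / z\<close> is largest. If the maximal ratio \<open>t\<close> were above
  \<open>1\<close>, then \<open>s y = T y + b \<le> t (T z) + b < t (T z + b) = t (s z)\<close> in every component,
  whereas \<open>y = t z\<close> in the component where \<open>t\<close> is attained.
\<close>

lemma resolvent_solution_le:
  fixes T :: "real ^ 'n::finite \<Rightarrow> real ^ 'n"
  assumes mono: "\<And>y z. 0 \<le> y \<Longrightarrow> y \<le> z \<Longrightarrow> T y \<le> T z"
    and hom: "\<And>t y. 0 \<le> t \<Longrightarrow> T (t *\<^sub>R y) = t *\<^sub>R T y"
    and b: "positive_vec b"
    and y: "positive_vec y" "s *\<^sub>R y = T y + b"
    and z: "positive_vec z" "s *\<^sub>R z = T z + b"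
  shows "y \<le> z"
proof -
  define t where "t = Max (range (\<lambda>i. y $ i / z $ i))"
  have zpos: "0 < z $ i" and ypos: "0 < y $ i" for i using z(1) y(1) by (auto simp: positive_vec_def)
  have le_t: "y $ i / z $ i \<le> t" for i unfolding t_def by (rule Max_ge) auto
  have y_le: "y $ i \<le> t * z $ i" for i
    using le_t[of i] zpos[of i] by (simp add: pos_divide_le_eq)
  have "t \<in> range (\<lambda>i. y $ i / z $ i)" unfolding t_def by (rule Max_in) auto
  then obtain i where i: "t = y $ i / z $ i" by blast
  have t0: "0 < t" using i ypos[of i] zpos[of i] by simp
  have "t \<le> 1"
  proof (rule ccontr)
    assume "\<not> t \<le> 1"
    have "T y \<le> T (t *\<^sub>R z)"
      using y_le ypos by (intro mono) (auto simp: less_eq_vec_def less_imp_le)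
    then have "T y $ i \<le> t * T z $ i" using hom[of t z] t0 by (simp add: less_eq_vec_def)
    moreover have "b $ i < t * b $ i"
      using b \<open>\<not> t \<le> 1\<close> by (simp add: positive_vec_def)
    ultimately have "(s *\<^sub>R y) $ i < t * (s *\<^sub>R z) $ i"
      unfolding y(2) z(2) by (simp add: distrib_left)
    moreover have "y $ i = t * z $ i" using i zpos[of i] by (simp add: field_simps)
    ultimately show False by (simp add: mult.left_commute)
  qed
  have "y $ i \<le> z $ i" for i
    using order_trans[OF y_le[of i] mult_right_mono[OF \<open>t \<le> 1\<close>, of "z $ i"]] zpos[of i]
    by simp
  then show ?thesis by (simp add: less_eq_vec_def)
qed

section \<open>Tensors as order-preserving homogeneous maps\<close>

lemma tensor_apply_mono:
  assumes "1 \<le> m" and "nonneg_tensor m B" and "0 \<le> x" and "x \<le> y"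
  shows "tensor_apply m B x \<le> tensor_apply m B y"
proof -
  have "0 \<le> (\<Prod>j\<leftarrow>js. x $ j) \<and> (\<Prod>j\<leftarrow>js. x $ j) \<le> (\<Prod>j\<leftarrow>js. y $ j)" for js
    using assms(3,4) by (induction js) (auto simp: less_eq_vec_def intro!: mult_mono intro: order_trans)
  then show ?thesis
    using assms(1,2) unfolding tensor_apply_def less_eq_vec_def nonneg_tensor_def
    by (auto intro!: sum_mono mult_left_mono)
qed

lemma tensor_apply_unit_tensor:
  assumes "1 \<le> m"
  shows "tensor_apply m (unit_tensor m) x = vec_power x (m - 1)"
proof -
  have iff: "(\<exists>l. i # js = replicate m l) \<longleftrightarrow> js = replicate (m - 1) i" for i :: 'n and js
    using assms by (cases m) auto
  have "(\<Sum>js | length js = m - 1. unit_tensor m (i # js) * (\<Prod>j\<leftarrow>js. x $ j)) = x $ i ^ (m - 1)" for i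
  proof -
    have "(\<Sum>js | length js = m - 1. unit_tensor m (i # js) * (\<Prod>j\<leftarrow>js. x $ j))
        = (\<Sum>js | length js = m - 1. if js = replicate (m - 1) i then \<Prod>j\<leftarrow>js. x $ j else 0)"
      unfolding unit_tensor_def iff by (intro sum.cong) auto
    also have "\<dots> = x $ i ^ (m - 1)"
      by (subst sum.delta) (auto simp: finite_index_lists map_replicate_const prod_list_replicate)
    finally show ?thesis .
  qed
  then show ?thesis by (simp add: tensor_apply_def vec_power_def)
qed

lemma tensor_apply_diff:
  "tensor_apply m (\<lambda>is. c * P is - Q is) x = c *\<^sub>R tensor_apply m P x - tensor_apply m Q x"
  unfolding tensor_apply_def
  by (simp add: vec_eq_iff left_diff_distrib sum_subtractf sum_distrib_left mult.assoc)

definition vec_root :: "nat \<Rightarrow> real ^ 'n \<Rightarrow> real ^ 'n::finite" where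
  "vec_root k y = (\<chi> i. root k (y $ i))"

lemma vec_root_vec_power: "0 < k \<Longrightarrow> 0 \<le> x \<Longrightarrow> vec_root k (vec_power x k) = x"
  by (simp add: vec_root_def vec_power_def vec_eq_iff less_eq_vec_def real_root_power_cancel)

lemma vec_power_vec_root: "0 < k \<Longrightarrow> 0 \<le> y \<Longrightarrow> vec_power (vec_root k y) k = y"
  by (simp add: vec_root_def vec_power_def vec_eq_iff less_eq_vec_def)

text \<open>
  The \<open>k\<close>-th root undoes the degree \<open>k\<close> of \<open>B x\<^bsup>k\<^esup>\<close>, which makes \<open>T\<close> homogeneous of
  degree one and turns the tensor eigenvalue equation into \<open>T z = \<mu> z\<close>. The definition of the
  spectral radius is then available for bounding \<open>\<mu>\<close>: the root of \<open>z\<close> is an eigenvector of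
  \<open>B\<close>, so the supremum is over a nonempty set.
\<close>

lemma tensor_apply_vec_root:
  fixes B :: "'n::finite tensor"
  assumes "2 \<le> m" and "nonneg_tensor m B"
  defines "T \<equiv> \<lambda>y. tensor_apply m B (vec_root (m - 1) y)"
  shows "continuous_on S T"
    and "0 \<le> y \<Longrightarrow> y \<le> z \<Longrightarrow> T y \<le> T z"
    and "0 \<le> t \<Longrightarrow> T (t *\<^sub>R y) = t *\<^sub>R T y"
    and "0 \<le> z \<Longrightarrow> z \<noteq> 0 \<Longrightarrow> T z = \<mu> *\<^sub>R z \<Longrightarrow> \<mu> \<le> tensor_spectral_radius m B"
proof -
  have k: "0 < m - 1" using assms(1) by simp
  show "continuous_on S T"
    unfolding T_def vec_root_def
    by (intro continuous_on_compose2[OF continuous_on_tensor_apply[of UNIV]] continuous_intros) auto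
  show "T y \<le> T z" if "0 \<le> y" "y \<le> z"
    unfolding T_def using assms(1,2) that k
    by (intro tensor_apply_mono) (auto simp: vec_root_def less_eq_vec_def)
  show "T (t *\<^sub>R y) = t *\<^sub>R T y" if "0 \<le> t"
  proof -
    have "vec_root (m - 1) (t *\<^sub>R y) = root (m - 1) t *\<^sub>R vec_root (m - 1) y"
      by (simp add: vec_root_def vec_eq_iff real_root_mult)
    then show ?thesis using k that by (simp add: T_def tensor_apply_scale)
  qed
  show "\<mu> \<le> tensor_spectral_radius m B" if z: "0 \<le> z" "z \<noteq> 0" "T z = \<mu> *\<^sub>R z"
  proof -
    let ?x = "vec_root (m - 1) z"
    have pow: "vec_power ?x (m - 1) = z" using k z(1) by (rule vec_power_vec_root)
    have "?x \<noteq> 0"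
    proof
      assume "?x = 0"
      then have "vec_power ?x (m - 1) = 0" using k by (simp add: vec_power_def vec_eq_iff)
      then show False using pow z(2) by simp
    qed
    then have "tensor_eigenvalue m B \<mu>"
      unfolding tensor_eigenvalue_def using z(3) pow by (auto simp: T_def)
    from tensor_spectral_radius_is_max(2)[OF this this] show ?thesis by simp
  qed
qed

section \<open>The tensor absolute value equation\<close>

theorem theorem3p4:
  fixes m :: nat and A B :: "'n::finite tensor" and c :: real and b :: "real ^ 'n"
  assumes "m \<ge> 2"
    and "A \<in> tensors m"
    and "B \<in> tensors m"
    and "A = (\<lambda>is. c * unit_tensor m is - B is)"
    and "nonneg_tensor m B"
    and "c > tensor_spectral_radius m B + 1"
    and "positive_vec b"
  shows "\<exists>!x. positive_vec x \<and> tensor_apply m A x - vec_power \<bar>x\<bar> (m - 1) = b"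
proof -
  define k where "k = m - 1"
  have k: "0 < k" using assms(1) by (simp add: k_def)
  define T where "T y = tensor_apply m B (vec_root k y)" for y
  note T = tensor_apply_vec_root[OF assms(1,5), folded k_def, folded T_def]
  have eig: "\<mu> < c - 1" if "0 \<le> z" "z \<noteq> 0" "T z = \<mu> *\<^sub>R z" for \<mu> z
    using T(4)[OF that] assms(6) by simp
  have pos: "0 \<le> x" if "positive_vec x" for x :: "real ^ 'n"
    using that by (auto simp: positive_vec_def less_eq_vec_def less_imp_le)
  have eq_iff: "tensor_apply m A x - vec_power \<bar>x\<bar> (m - 1) = b \<longleftrightarrow>
      (c - 1) *\<^sub>R vec_power x k = T (vec_power x k) + b" if "positive_vec x" for x
  proof -
    have "\<bar>x\<bar> = x" using pos[OF that] by (simp add: abs_vec_def less_eq_vec_def vec_eq_iff)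
    moreover have "tensor_apply m A x = c *\<^sub>R vec_power x k - T (vec_power x k)"
      using assms(1) k pos[OF that] unfolding assms(4) tensor_apply_diff T_def
      by (simp add: tensor_apply_unit_tensor vec_root_vec_power k_def)
    ultimately show ?thesis by (auto simp: k_def scaleR_left_diff_distrib algebra_simps)
  qed
  have pow_pos: "positive_vec (vec_power x k)" if "positive_vec x" for x :: "real ^ 'n"
    using that by (simp add: positive_vec_def vec_power_def)
  show ?thesis
  proof (rule ex_ex1I)
    obtain y where y: "positive_vec y" "(c - 1) *\<^sub>R y = T y + b"
      by (rule resolvent_solution_exists[of T "c - 1" b]) (use T(1,2,3) eig assms(7) in blast)+
    have x: "positive_vec (vec_root k y)" using y(1) k by (simp add: positive_vec_def vec_root_def)
    have "vec_power (vec_root k y) k = y" using k pos[OF y(1)] by (rule vec_power_vec_root)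
    then show "\<exists>x. positive_vec x \<and> tensor_apply m A x - vec_power \<bar>x\<bar> (m - 1) = b"
      using eq_iff[OF x] x y(2) by auto
  next
    fix x x'
    assume x: "positive_vec x \<and> tensor_apply m A x - vec_power \<bar>x\<bar> (m - 1) = b"
      and x': "positive_vec x' \<and> tensor_apply m A x' - vec_power \<bar>x'\<bar> (m - 1) = b"
    let ?y = "vec_power x k" and ?y' = "vec_power x' k"
    have y: "positive_vec ?y" "(c - 1) *\<^sub>R ?y = T ?y + b" using x eq_iff pow_pos by auto
    have y': "positive_vec ?y'" "(c - 1) *\<^sub>R ?y' = T ?y' + b" using x' eq_iff pow_pos by auto
    have "?y = ?y'"
      using resolvent_solution_le[OF _ _ assms(7) y y'] resolvent_solution_le[OF _ _ assms(7) y' y]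
        T(2,3) by (blast intro: order_antisym)
    then show "x = x'" using k x x' pos vec_root_vec_power by metis
  qed
qed

end
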